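(* Let $G$ and $H$ be graphs with $\alpha^*(G|H)\le 1$. Then $G\in Expand(H)$ in each of the following cases: (i) $G$ is the Cayley graph $Cay(\mathbb Z_n,\pm1,\pm2,\dots,\pm k)$ where $n=c(k+1)+1$ or $n=c(k+1)$ for some integer $c$, and $H$ is arbitrary; (ii) $G$ is a perfect graph and $H$ is arbitrary.
   Context: All graphs are finite, simple, undirected; $\boxtimes$ is the strong product, $\alpha^*(G|H)=\sup_W\frac{\alpha(G\boxtimes W)}{\alpha(H\boxtimes W)}$ over all graphs $W$. $Cay(\mathbb Z_n,\pm1,\dots,\pm k)$ has vertex set $\mathbb Z_n$ with $a,b$ adjacent iff $a-b\in\{\pm1,\dots,\pm k\}$. For a graph $K$, $Expand(K)$ is the set of all graphs obtainable from $K$ by a finite sequence of the operations: (I) remove a vertex; (II) replace a vertex $v$ by a clique of arbitrary size, each new vertex joined to all neighbors of $v$; (III) add a new edge. *)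

theory Defs
  imports "HOL-Library.Extended_Real" "HOL-Number_Theory.Cong"
begin

record 'a ugraph =
  verts :: "'a set"
  edges :: "'a set set"

definition simple_graph :: "'a ugraph \<Rightarrow> bool" where
  "simple_graph G \<longleftrightarrow>
     finite (verts G) \<and>
     edges G \<subseteq> {{u, v} | u v. u \<in> verts G \<and> v \<in> verts G \<and> u \<noteq> v}"

definition graph_iso :: "'a ugraph \<Rightarrow> 'b ugraph \<Rightarrow> bool" where
  "graph_iso G H \<longleftrightarrow>
     (\<exists>f. bij_betw f (verts G) (verts H) \<and>
          (\<forall>u\<in>verts G. \<forall>v\<in>verts G. {u, v} \<in> edges G \<longleftrightarrow> {f u, f v} \<in> edges H))"

definition induced_subgraph :: "'a ugraph \<Rightarrow> 'a set \<Rightarrow> 'a ugraph" where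
  "induced_subgraph G U = \<lparr>verts = U, edges = {e \<in> edges G. e \<subseteq> U}\<rparr>"


definition independent_set :: "'a ugraph \<Rightarrow> 'a set \<Rightarrow> bool" where
  "independent_set G S \<longleftrightarrow>
     S \<subseteq> verts G \<and> (\<forall>u\<in>S. \<forall>v\<in>S. u \<noteq> v \<longrightarrow> {u, v} \<notin> edges G)"

definition independence_number :: "'a ugraph \<Rightarrow> nat" where
  "independence_number G = Max {card S | S. independent_set G S}"

definition clique :: "'a ugraph \<Rightarrow> 'a set \<Rightarrow> bool" where
  "clique G C \<longleftrightarrow>
     C \<subseteq> verts G \<and> (\<forall>u\<in>C. \<forall>v\<in>C. u \<noteq> v \<longrightarrow> {u, v} \<in> edges G)"

definition clique_number :: "'a ugraph \<Rightarrow> nat" where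
  "clique_number G = Max {card C | C. clique G C}"

definition colourable :: "'a ugraph \<Rightarrow> nat \<Rightarrow> bool" where
  "colourable G k \<longleftrightarrow>
     (\<exists>f. f ` verts G \<subseteq> {..<k} \<and>
          (\<forall>u\<in>verts G. \<forall>v\<in>verts G. {u, v} \<in> edges G \<longrightarrow> f u \<noteq> f v))"

definition chromatic_number :: "'a ugraph \<Rightarrow> nat" where
  "chromatic_number G = (LEAST k. colourable G k)"

definition perfect :: "'a ugraph \<Rightarrow> bool" where
  "perfect G \<longleftrightarrow>
     (\<forall>U\<subseteq>verts G.
        chromatic_number (induced_subgraph G U) = clique_number (induced_subgraph G U))"


definition strong_product :: "'a ugraph \<Rightarrow> 'b ugraph \<Rightarrow> ('a \<times> 'b) ugraph" where
  "strong_product G H =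
     \<lparr>verts = verts G \<times> verts H,
      edges = {{(u, x), (v, y)} | u v x y.
        u \<in> verts G \<and> v \<in> verts G \<and> x \<in> verts H \<and> y \<in> verts H \<and>
        (u, x) \<noteq> (v, y) \<and>
        (u = v \<or> {u, v} \<in> edges G) \<and> (x = y \<or> {x, y} \<in> edges H)}\<rparr>"

text \<open>
  The supremum ranges over all nonempty finite simple graphs up to isomorphism, represented on
  vertex sets of natural numbers. It is taken in the extended reals, so that
  no boundedness is presupposed. If \<open>H\<close> has a vertex, then all denominators are positive;
  if \<open>H\<close> is empty, then \<open>a / 0 = \<infinity>\<close> for \<open>a > 0\<close> and \<open>0 / 0 = 0\<close>.
\<close>

definition alpha_star :: "'a ugraph \<Rightarrow> 'b ugraph \<Rightarrow> ereal" where
  "alpha_star G H =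
     (SUP W \<in> {W :: nat ugraph. simple_graph W \<and> verts W \<noteq> {}}.
        ereal (real (independence_number (strong_product G W))) /
        ereal (real (independence_number (strong_product H W))))"


text \<open>
  The residues \<open>0, \<dots>, n - 1\<close> represent \<open>\<int>/n\<int>\<close>. Loops are excluded explicitly; they
  could only arise when \<open>n \<le> k\<close>.
\<close>

definition cayley_cyclic :: "nat \<Rightarrow> nat \<Rightarrow> int ugraph" where
  "cayley_cyclic n k =
     \<lparr>verts = {0..<int n},
      edges = {{a, b} | a b.
        a \<in> {0..<int n} \<and> b \<in> {0..<int n} \<and> a \<noteq> b \<and>
        (\<exists>j\<in>{1..int k}. [a - b = j] (mod int n) \<or> [a - b = - j] (mod int n))}\<rparr>"


definition remove_vertex :: "'a ugraph \<Rightarrow> 'a \<Rightarrow> 'a ugraph" where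
  "remove_vertex K v = induced_subgraph K (verts K - {v})"

definition replace_by_clique :: "'a ugraph \<Rightarrow> 'a \<Rightarrow> 'a set \<Rightarrow> 'a ugraph" where
  "replace_by_clique K v C =
     \<lparr>verts = (verts K - {v}) \<union> C,
      edges = {e \<in> edges K. v \<notin> e} \<union>
              {{x, y} | x y. x \<in> C \<and> y \<in> C \<and> x \<noteq> y} \<union>
              {{x, u} | x u. x \<in> C \<and> {v, u} \<in> edges K}\<rparr>"

definition add_edge :: "'a ugraph \<Rightarrow> 'a \<Rightarrow> 'a \<Rightarrow> 'a ugraph" where
  "add_edge K u v = \<lparr>verts = verts K, edges = insert {u, v} (edges K)\<rparr>"

text \<open>In the second rule, the clique \<open>C\<close> may reuse the name of the vertex \<open>v\<close> it replaces.\<close>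

inductive expand_step :: "'a ugraph \<Rightarrow> 'a ugraph \<Rightarrow> bool" where
  remove: "v \<in> verts K \<Longrightarrow> expand_step K (remove_vertex K v)"
| replace: "v \<in> verts K \<Longrightarrow> finite C \<Longrightarrow> C \<inter> (verts K - {v}) = {} \<Longrightarrow>
    expand_step K (replace_by_clique K v C)"
| add: "u \<in> verts K \<Longrightarrow> v \<in> verts K \<Longrightarrow> u \<noteq> v \<Longrightarrow> {u, v} \<notin> edges K \<Longrightarrow>
    expand_step K (add_edge K u v)"

text \<open>
  Graphs are considered up to isomorphism. The operations are performed on an isomorphic copy
  with natural numbers as vertices, so that fresh vertices are always available for cliques,
  whatever the vertex types of \<open>H\<close> and \<open>G\<close> are.
\<close>

definition Expand :: "'b ugraph \<Rightarrow> 'a ugraph set" where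
  "Expand H =
     {G. simple_graph G \<and>
         (\<exists>H' G' :: nat ugraph. simple_graph H' \<and> graph_iso H H' \<and>
            expand_step\<^sup>*\<^sup>* H' G' \<and> graph_iso G' G)}"

end

theory Submission
  imports Defs
begin

text \<open>
  \<^term>\<open>G \<in> Expand H\<close> holds as soon as the complement of \<^term>\<open>G\<close> maps homomorphically to that
  of \<^term>\<open>H\<close>: blow up every vertex of \<^term>\<open>H\<close> to its fibre, then add the missing edges.
  A cover of \<^term>\<open>G\<close> by \<open>m\<close> cliques together with an independent set of size \<open>m\<close> in \<^term>\<open>H\<close>
  gives such a map. This settles every \<^term>\<open>G\<close> whose clique cover number is its independence
  number, in particular perfect graphs (weak perfect graph theorem) and \<open>n = c (k + 1)\<close>.

  For \<open>n = c (k + 1) + 1\<close>, testing with the complement of \<^term>\<open>G\<close> as \<open>W\<close> yields independent sets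
  \<open>S v\<close> of \<^term>\<open>H\<close> with total size at least \<open>n\<close>, such that \<open>S u\<close> and \<open>S v\<close> are disjoint and
  without edges between them whenever \<open>u \<noteq> v\<close> are nonadjacent. The \<open>c\<close> sets along a progression
  of step \<open>k + 1\<close> unite to an independent set. Either one of these unions has more than \<open>c\<close>
  elements, and \<open>c + 1\<close> cliques cover \<^term>\<open>G\<close>; or, by averaging, all have exactly \<open>c\<close>, which
  forces \<open>card (S v)\<close> to be constant, hence positive, and any choice from the \<open>S v\<close> is a
  homomorphism of complements.
\<close>

section \<open>Independent sets and domination\<close>

lemma edge_in_vertsD:
  assumes "simple_graph G" "{u, v} \<in> edges G"
  shows "u \<in> verts G" "v \<in> verts G" "u \<noteq> v"
proof -
  from assms obtain a b where "{u, v} = {a, b}" "a \<in> verts G" "b \<in> verts G" "a \<noteq> b"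
    unfolding simple_graph_def by blast
  then show "u \<in> verts G" "v \<in> verts G" "u \<noteq> v"
    by (auto simp: doubleton_eq_iff)
qed

lemma finite_independent_cards:
  assumes "finite (verts G)"
  shows "finite {card S | S. independent_set G S}"
proof (rule finite_subset)
  show "{card S | S. independent_set G S} \<subseteq> card ` Pow (verts G)"
    by (auto simp: independent_set_def)
qed (use assms in auto)

lemma card_le_independence_number:
  assumes "finite (verts G)" "independent_set G S"
  shows "card S \<le> independence_number G"
  unfolding independence_number_def
  by (rule Max_ge[OF finite_independent_cards]) (use assms in auto)

lemma independence_number_attained:
  assumes "finite (verts G)"
  obtains S where "independent_set G S" "card S = independence_number G"
proof -
  have "independent_set G {}"
    by (simp add: independent_set_def)
  then have "independence_number G \<in> {card S | S. independent_set G S}"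
    unfolding independence_number_def
    by (intro Max_in finite_independent_cards[OF assms]) blast
  then show thesis
    using that by auto
qed

section \<open>Strong products and test graphs\<close>

lemma verts_strong_product [simp]: "verts (strong_product G H) = verts G \<times> verts H"
  by (simp add: strong_product_def)

text \<open>Edges are unordered pairs, so the set comprehension fixes the coordinates only up to a
  swap of the endpoints; the condition is symmetric, and both readings agree.\<close>

lemma strong_product_edge_iff:
  "{(u, x), (v, y)} \<in> edges (strong_product G H) \<longleftrightarrow>
     u \<in> verts G \<and> v \<in> verts G \<and> x \<in> verts H \<and> y \<in> verts H \<and> (u, x) \<noteq> (v, y) \<and>
     (u = v \<or> {u, v} \<in> edges G) \<and> (x = y \<or> {x, y} \<in> edges H)"
    (is "_ \<longleftrightarrow> ?R u x v y")
proof
  assume "{(u, x), (v, y)} \<in> edges (strong_product G H)"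
  then obtain u' x' v' y' where eq: "{(u, x), (v, y)} = {(u', x'), (v', y')}" and R: "?R u' x' v' y'"
    unfolding strong_product_def by auto
  from eq consider "u = u'" "x = x'" "v = v'" "y = y'" | "u = v'" "x = y'" "v = u'" "y = x'"
    by (auto simp: doubleton_eq_iff)
  then show "?R u x v y"
    using R by cases (auto simp: insert_commute)
next
  assume "?R u x v y"
  then show "{(u, x), (v, y)} \<in> edges (strong_product G H)"
    unfolding strong_product_def by auto
qed

text \<open>Each \<open>W\<close> contributes one of the quotients whose supremum is
  \<open>alpha_star G H\<close>.\<close>

lemma independence_number_le_if_alpha_star_le_1:
  fixes W :: "nat ugraph"
  assumes "alpha_star G H \<le> 1" "simple_graph W" "verts W \<noteq> {}"
  shows "independence_number (strong_product G W) \<le> independence_number (strong_product H W)"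
proof -
  let ?a = "independence_number (strong_product G W)"
  let ?b = "independence_number (strong_product H W)"
  have "ereal (real ?a) / ereal (real ?b) \<le> alpha_star G H"
    unfolding alpha_star_def by (rule SUP_upper) (use assms in auto)
  with assms(1) have "ereal (real ?a) / ereal (real ?b) \<le> 1"
    by (rule order_trans[rotated])
  \<comment> \<open>If \<open>?b = 0\<close>, the quotient is \<infinity> unless
    \<open>?a = 0\<close>, so the bound 1 still gives \<open>?a \<le> ?b\<close>.\<close>
  then show ?thesis
    by (cases "?b = 0"; cases "?a = 0") (auto simp: divide_ereal_def one_ereal_def field_simps)
qed

text \<open>The strong product with a one-vertex graph \<open>W\<close> is a copy of the graph
  itself, so this test compares the independence numbers of \<open>G\<close> and
  \<open>H\<close>.\<close>

lemma dominated_independent_set: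
  fixes G :: "'a ugraph" and H :: "'b ugraph"
  assumes "finite (verts G)" "finite (verts H)" "alpha_star G H \<le> 1" "independent_set G A"
  obtains B where "independent_set H B" "card A \<le> card B"
proof -
  define W :: "nat ugraph" where "W = \<lparr>verts = {0}, edges = {}\<rparr>"
  have W: "simple_graph W" "verts W = {0}" "edges W = {}"
    by (auto simp: W_def simple_graph_def)
  have "independent_set (strong_product G W) (A \<times> {0})"
    using assms(4) W by (auto simp: independent_set_def strong_product_edge_iff)
  then have "card (A \<times> {0::nat}) \<le> independence_number (strong_product G W)"
    by (intro card_le_independence_number) (use assms W in auto)
  also have "\<dots> \<le> independence_number (strong_product H W)"
    by (rule independence_number_le_if_alpha_star_le_1) (use assms W in auto)
  finally have le: "card A \<le> independence_number (strong_product H W)"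
    by (simp add: card_cartesian_product)
  obtain S where S: "independent_set (strong_product H W) S"
      "card S = independence_number (strong_product H W)"
    by (rule independence_number_attained[of "strong_product H W"]) (use assms W in auto)
  have snd0: "snd p = 0" if "p \<in> S" for p
    using S(1) that W by (auto simp: independent_set_def)
  have "inj_on fst S"
    by (rule inj_onI) (metis snd0 prod_eqI)
  then have "card (fst ` S) = card S"
    by (rule card_image)
  moreover have "independent_set H (fst ` S)"
    unfolding independent_set_def
  proof (intro conjI ballI impI)
    show "fst ` S \<subseteq> verts H"
      using S(1) by (auto simp: independent_set_def)
    fix u v assume "u \<in> fst ` S" "v \<in> fst ` S" "u \<noteq> v"
    then have "(u, 0) \<in> S" "(v, 0) \<in> S"
      using snd0 by (force simp: prod_eq_iff)+
    moreover from this have "{(u, 0), (v, 0)} \<notin> edges (strong_product H W)"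
      using S(1) \<open>u \<noteq> v\<close> unfolding independent_set_def by blast
    moreover have "S \<subseteq> verts H \<times> {0}"
      using S(1) W by (simp add: independent_set_def)
    ultimately show "{u, v} \<notin> edges H"
      using \<open>u \<noteq> v\<close> W by (auto simp: strong_product_edge_iff)
  qed
  ultimately show thesis
    using that[of "fst ` S"] le S(2) by simp
qed

text \<open>Testing with the complement of \<^term>\<open>G\<close> as \<open>W\<close>: the diagonal is independent in the
  strong product of \<^term>\<open>G\<close> with its complement, and the sets \<^term>\<open>S v\<close> are the fibres of an
  independent set of the same size over \<^term>\<open>H\<close>.\<close>

lemma dominated_independent_family:
  fixes G :: "'a ugraph" and H :: "'b ugraph"
  assumes "simple_graph G" "simple_graph H" "alpha_star G H \<le> 1" "verts G \<noteq> {}"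
  obtains S :: "'a \<Rightarrow> 'b set" where
    "\<And>v. v \<in> verts G \<Longrightarrow> independent_set H (S v)"
    "\<And>u v x y. \<lbrakk>u \<in> verts G; v \<in> verts G; u \<noteq> v; {u, v} \<notin> edges G; x \<in> S u; y \<in> S v\<rbrakk>
       \<Longrightarrow> x \<noteq> y \<and> {x, y} \<notin> edges H"
    "card (verts G) \<le> (\<Sum>v\<in>verts G. card (S v))"
proof -
  have fin: "finite (verts G)" "finite (verts H)"
    using assms by (auto simp: simple_graph_def)
  obtain q :: "'a \<Rightarrow> nat" where q: "inj_on q (verts G)"
    using finite_imp_inj_to_nat_seg[OF fin(1)] by blast
  \<comment> \<open>Test graphs live on natural numbers, so the complement of \<open>G\<close> is
    transported along the injection \<open>q\<close>.\<close>
  define W :: "nat ugraph" where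
    "W = \<lparr>verts = q ` verts G,
          edges = {{q u, q v} | u v. u \<in> verts G \<and> v \<in> verts G \<and> u \<noteq> v \<and> {u, v} \<notin> edges G}\<rparr>"
  have vW: "verts W = q ` verts G"
    by (simp add: W_def)
  have sW: "simple_graph W"
  proof -
    have "edges W \<subseteq> {{x, y} | x y. x \<in> verts W \<and> y \<in> verts W \<and> x \<noteq> y}"
    proof
      fix e assume "e \<in> edges W"
      then obtain u v where "e = {q u, q v}" "u \<in> verts G" "v \<in> verts G" "u \<noteq> v"
        by (auto simp: W_def)
      moreover from this have "q u \<noteq> q v"
        using q by (auto dest: inj_onD)
      ultimately show "e \<in> {{x, y} | x y. x \<in> verts W \<and> y \<in> verts W \<and> x \<noteq> y}"
        unfolding vW by blast
    qed
    then show ?thesis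
      using fin by (simp add: simple_graph_def vW)
  qed
  have eW: "{q u, q v} \<in> edges W \<longleftrightarrow> u \<noteq> v \<and> {u, v} \<notin> edges G"
    if "u \<in> verts G" "v \<in> verts G" for u v
  proof
    assume "{q u, q v} \<in> edges W"
    then obtain u' v' where "{q u, q v} = {q u', q v'}" "u' \<in> verts G" "v' \<in> verts G"
        "u' \<noteq> v'" "{u', v'} \<notin> edges G"
      by (auto simp: W_def)
    moreover from this have "u = u' \<and> v = v' \<or> u = v' \<and> v = u'"
      using q that by (auto simp: doubleton_eq_iff inj_on_eq_iff)
    ultimately show "u \<noteq> v \<and> {u, v} \<notin> edges G"
      by (auto simp: insert_commute)
  qed (use that in \<open>auto simp: W_def\<close>)
  define D where "D = (\<lambda>v. (v, q v)) ` verts G"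
  have "independent_set (strong_product G W) D"
    unfolding independent_set_def D_def
    using q by (auto simp: vW strong_product_edge_iff eW inj_on_eq_iff)
  then have "card D \<le> independence_number (strong_product G W)"
    by (intro card_le_independence_number) (use fin vW in auto)
  moreover have "card D = card (verts G)"
    unfolding D_def by (rule card_image) (auto simp: inj_on_def)
  moreover have "independence_number (strong_product G W) \<le> independence_number (strong_product H W)"
    by (rule independence_number_le_if_alpha_star_le_1) (use assms sW vW in auto)
  moreover obtain R where R: "independent_set (strong_product H W) R"
      "card R = independence_number (strong_product H W)"
    by (rule independence_number_attained[of "strong_product H W"]) (use fin vW in auto)
  ultimately have cR: "card (verts G) \<le> card R"
    by simp
  define S where "S v = {x. (x, q v) \<in> R}" for v
  have RV: "R \<subseteq> verts H \<times> q ` verts G"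
    using R(1) by (simp add: independent_set_def vW)
  \<comment> \<open>This has two uses: for \<open>u = v\<close> it makes each fibre independent, and
    for distinct nonadjacent \<open>u\<close>, \<open>v\<close>, whose images are adjacent in
    \<open>W\<close>, it separates the two fibres.\<close>
  have nadj: "\<not> ((x = y \<or> {x, y} \<in> edges H) \<and> (q u = q v \<or> {q u, q v} \<in> edges W))"
    if "x \<in> S u" "y \<in> S v" "(x, q u) \<noteq> (y, q v)" for x y u v
  proof -
    have "(x, q u) \<in> R" "(y, q v) \<in> R"
      using that by (auto simp: S_def)
    moreover from this have "{(x, q u), (y, q v)} \<notin> edges (strong_product H W)"
      using R(1) that unfolding independent_set_def by blast
    ultimately show ?thesis
      using RV that by (auto simp: strong_product_edge_iff vW)
  qed
  have SV: "S v \<subseteq> verts H" for v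
    using RV by (auto simp: S_def)
  have "R = (\<Union>v\<in>verts G. (\<lambda>x. (x, q v)) ` S v)"
    using RV by (fastforce simp: S_def image_iff)
  then have "card R \<le> (\<Sum>v\<in>verts G. card ((\<lambda>x. (x, q v)) ` S v))"
    using card_UN_le[OF fin(1), of "\<lambda>v. (\<lambda>x. (x, q v)) ` S v"] by simp
  also have "\<dots> \<le> (\<Sum>v\<in>verts G. card (S v))"
    by (intro sum_mono card_image_le finite_subset[OF SV fin(2)])
  finally have "card (verts G) \<le> (\<Sum>v\<in>verts G. card (S v))"
    using cR by simp
  moreover have "independent_set H (S v)" if "v \<in> verts G" for v
    unfolding independent_set_def using SV nadj[of _ v _ v] by auto
  moreover have "x \<noteq> y \<and> {x, y} \<notin> edges H"
    if "u \<in> verts G" "v \<in> verts G" "u \<noteq> v" "{u, v} \<notin> edges G" "x \<in> S u" "y \<in> S v" for u v x y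
    using nadj[of x u y v] that eW[of u v] q by (auto simp: inj_on_eq_iff)
  ultimately show thesis
    using that[of S] by blast
qed

section \<open>Expansion as a homomorphism of complements\<close>

text \<open>A graph homomorphism between the complements, spelled out without forming them.\<close>

definition co_hom :: "'a ugraph \<Rightarrow> 'b ugraph \<Rightarrow> ('a \<Rightarrow> 'b) \<Rightarrow> bool" where
  "co_hom G H f \<longleftrightarrow> f ` verts G \<subseteq> verts H \<and>
     (\<forall>u\<in>verts G. \<forall>v\<in>verts G. u \<noteq> v \<longrightarrow> {u, v} \<notin> edges G \<longrightarrow> f u \<noteq> f v \<and> {f u, f v} \<notin> edges H)"

lemma co_homD:
  assumes "co_hom G H f" "u \<in> verts G" "v \<in> verts G" "u \<noteq> v" "{u, v} \<notin> edges G"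
  shows "f u \<noteq> f v" "{f u, f v} \<notin> edges H"
  using assms by (auto simp: co_hom_def)

section \<open>Relabelled copies and blow-ups\<close>

definition copy_graph :: "('a \<Rightarrow> 'b) \<Rightarrow> 'a ugraph \<Rightarrow> 'b ugraph" where
  "copy_graph g G = \<lparr>verts = g ` verts G, edges = (`) g ` edges G\<rparr>"

text \<open>\<open>r\<close> labels the points of \<open>X\<close> with vertices of a graph with
  edge set \<open>E\<close>. As \<open>X\<close> may mix original vertices and clones, this one form
  describes all stages of replacing vertices one after another.\<close>

definition blow_up :: "'a set set \<Rightarrow> ('b \<Rightarrow> 'a) \<Rightarrow> 'b set \<Rightarrow> 'b ugraph" where
  "blow_up E r X = \<lparr>verts = X,
     edges = {{x, y} | x y. x \<in> X \<and> y \<in> X \<and> x \<noteq> y \<and> (r x = r y \<or> {r x, r y} \<in> E)}\<rparr>"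

text \<open>Edges are subsets of \<open>verts G\<close>, and taking images under \<open>g\<close> is
  injective on such subsets.\<close>

lemma copy_graph_edge_iff:
  assumes "simple_graph G" "inj_on g (verts G)" "u \<in> verts G" "v \<in> verts G"
  shows "{g u, g v} \<in> edges (copy_graph g G) \<longleftrightarrow> {u, v} \<in> edges G"
proof -
  have "edges G \<subseteq> Pow (verts G)"
    using assms(1) by (auto simp: simple_graph_def)
  then have "g ` {u, v} \<in> (`) g ` edges G \<longleftrightarrow> {u, v} \<in> edges G"
    using assms by (intro inj_on_image_mem_iff[OF inj_on_image_Pow[OF assms(2)]]) auto
  then show ?thesis
    by (simp add: copy_graph_def)
qed

lemma simple_copy_graph:
  assumes "simple_graph G" "inj_on g (verts G)"
  shows "simple_graph (copy_graph g G)"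
proof -
  have "\<exists>a b. g ` e = {a, b} \<and> a \<in> g ` verts G \<and> b \<in> g ` verts G \<and> a \<noteq> b"
    if "e \<in> edges G" for e
  proof -
    from that assms(1) obtain u v where "e = {u, v}" "u \<in> verts G" "v \<in> verts G" "u \<noteq> v"
      unfolding simple_graph_def by blast
    then have "g ` e = {g u, g v}" "g u \<in> g ` verts G" "g v \<in> g ` verts G" "g u \<noteq> g v"
      using assms(2) by (auto simp: inj_on_eq_iff)
    then show ?thesis
      by blast
  qed
  moreover have "finite (verts G)"
    using assms(1) by (simp add: simple_graph_def)
  ultimately show ?thesis
    by (auto simp: simple_graph_def copy_graph_def)
qed

lemma graph_iso_copy_graph:
  assumes "simple_graph G" "inj_on g (verts G)"
  shows "graph_iso G (copy_graph g G)"
  unfolding graph_iso_def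
proof (intro exI conjI ballI)
  show "bij_betw g (verts G) (verts (copy_graph g G))"
    using assms(2) by (simp add: bij_betw_def copy_graph_def)
qed (simp add: copy_graph_edge_iff[OF assms])

lemma graph_iso_sym:
  assumes "graph_iso G H"
  shows "graph_iso H G"
proof -
  obtain f where f: "bij_betw f (verts G) (verts H)"
      "\<And>u v. u \<in> verts G \<Longrightarrow> v \<in> verts G \<Longrightarrow> {u, v} \<in> edges G \<longleftrightarrow> {f u, f v} \<in> edges H"
    using assms by (auto simp: graph_iso_def)
  let ?g = "inv_into (verts G) f"
  have g: "?g y \<in> verts G \<and> f (?g y) = y" if "y \<in> verts H" for y
    using f(1) that by (metis bij_betw_def f_inv_into_f inv_into_into)
  show ?thesis
    unfolding graph_iso_def
  proof (intro exI conjI ballI)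
    show "bij_betw ?g (verts H) (verts G)"
      by (rule bij_betw_inv_into[OF f(1)])
    show "{u, v} \<in> edges H \<longleftrightarrow> {?g u, ?g v} \<in> edges G" if "u \<in> verts H" "v \<in> verts H" for u v
      using f(2)[of "?g u" "?g v"] g that by simp
  qed
qed

lemma verts_blow_up [simp]: "verts (blow_up E r X) = X"
  by (simp add: blow_up_def)

lemma blow_up_edge_iff:
  "{x, y} \<in> edges (blow_up E r X) \<longleftrightarrow>
     x \<in> X \<and> y \<in> X \<and> x \<noteq> y \<and> (r x = r y \<or> {r x, r y} \<in> E)"
    (is "_ \<longleftrightarrow> ?R x y")
proof
  assume "{x, y} \<in> edges (blow_up E r X)"
  then obtain x' y' where eq: "{x, y} = {x', y'}" and R: "?R x' y'"
    unfolding blow_up_def by auto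
  from eq consider "x = x'" "y = y'" | "x = y'" "y = x'"
    by (auto simp: doubleton_eq_iff)
  then show "?R x y"
    using R by cases (auto simp: insert_commute)
qed (auto simp: blow_up_def)

text \<open>Since \<open>v\<close> is the only point of \<open>X\<close> with label
  \<open>v\<close>, all its edges in the blow-up stem from \<open>E\<close>; the points of
  \<open>C\<close> carry the same label, so they inherit exactly these edges and form a
  clique.\<close>

lemma replace_by_clique_blow_up:
  assumes "v \<in> X" "r v = v" "\<And>x. x \<in> C \<Longrightarrow> r x = v" "\<And>x. x \<in> X \<Longrightarrow> r x = v \<Longrightarrow> x = v"
    "C \<inter> (X - {v}) = {}"
  shows "replace_by_clique (blow_up E r X) v C = blow_up E r (X - {v} \<union> C)"
proof -
  let ?X = "X - {v} \<union> C"
  have "edges (replace_by_clique (blow_up E r X) v C) = edges (blow_up E r ?X)" (is "?L = ?R")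
  proof (rule set_eqI, rule iffI)
    fix e assume "e \<in> ?L"
    then consider "e \<in> edges (blow_up E r X)" "v \<notin> e"
      | x y where "e = {x, y}" "x \<in> C" "y \<in> C" "x \<noteq> y"
      | x u where "e = {x, u}" "x \<in> C" "{v, u} \<in> edges (blow_up E r X)"
      unfolding replace_by_clique_def by auto
    then show "e \<in> ?R"
    proof cases
      case 1
      then obtain x y where "e = {x, y}"
        by (auto simp: blow_up_def)
      with 1 show ?thesis
        by (auto simp: blow_up_edge_iff)
    next
      case 2
      then show ?thesis
        using assms by (auto simp: blow_up_edge_iff)
    next
      case 3
      then have u: "u \<in> X" "v \<noteq> u" "r v = r u \<or> {r v, r u} \<in> E"
        by (simp_all add: blow_up_edge_iff)
      moreover from u have "r u \<noteq> v"
        using assms(4)[of u] by auto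
      ultimately have ru: "{v, r u} \<in> E"
        using assms(2) by auto
      with 3 have "x \<noteq> u"
        using assms(5) 3(2) u(1,2) by blast
      moreover have "x \<in> X - {v} \<union> C" "u \<in> X - {v} \<union> C" "r x = v"
        using 3 u assms(3) by auto
      ultimately show ?thesis
        using 3(1) ru by (simp add: blow_up_edge_iff)
    qed
  next
    fix e assume "e \<in> ?R"
    then obtain x y where e: "e = {x, y}"
      by (auto simp: blow_up_def)
    with \<open>e \<in> ?R\<close> have *: "x \<in> ?X" "y \<in> ?X" "x \<noteq> y" "r x = r y \<or> {r x, r y} \<in> E"
      by (simp_all add: blow_up_edge_iff)
    consider "x \<in> C" "y \<in> C" | "x \<in> C" "y \<in> X - {v}" | "y \<in> C" "x \<in> X - {v}"
      | "x \<in> X - {v}" "y \<in> X - {v}"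
      using * by auto
    then show "e \<in> ?L"
    proof cases
      case 1
      then show ?thesis
        using e * by (auto simp: replace_by_clique_def)
    next
      case 2
      then have "{v, y} \<in> edges (blow_up E r X)"
        using * assms(1-3) by (auto simp: blow_up_edge_iff)
      then show ?thesis
        using e 2 by (auto simp: replace_by_clique_def)
    next
      case 3
      then have "{v, x} \<in> edges (blow_up E r X)"
        using * assms(1-3) by (auto simp: blow_up_edge_iff insert_commute)
      moreover have "e = {y, x}"
        using e by auto
      ultimately show ?thesis
        using 3 unfolding replace_by_clique_def by auto
    next
      case 4
      then have "e \<in> edges (blow_up E r X)"
        using * e by (auto simp: blow_up_edge_iff)
      then show ?thesis
        using e 4 by (auto simp: replace_by_clique_def)
    qed
  qed
  then show ?thesis
    by (simp add: replace_by_clique_def blow_up_def)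
qed

text \<open>Induction on the set \<open>D\<close> of vertices already replaced by their fibres in
  \<open>Y\<close>. Where a fibre is empty, replacement by the empty clique deletes the
  vertex.\<close>

lemma expand_steps_blow_up:
  assumes "finite Y" "Y \<inter> V = {}" "r ` Y \<subseteq> V" "\<And>x. x \<in> V \<Longrightarrow> r x = x" "finite D" "D \<subseteq> V"
  shows "expand_step\<^sup>*\<^sup>* (blow_up E r V) (blow_up E r (V - D \<union> {y \<in> Y. r y \<in> D}))"
  using assms(5,6)
proof (induction D rule: finite_induct)
  case (insert v D)
  let ?X = "V - D \<union> {y \<in> Y. r y \<in> D}"
  let ?C = "{y \<in> Y. r y = v}"
  have eq: "V - insert v D \<union> {y \<in> Y. r y \<in> insert v D} = ?X - {v} \<union> ?C"
    using insert.prems insert.hyps(2) assms(2) by auto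
  have v: "v \<in> ?X"
    using insert by auto
  have fresh: "?C \<inter> (?X - {v}) = {}"
    using insert.hyps(2) assms(2) by auto
  have "expand_step (blow_up E r ?X) (replace_by_clique (blow_up E r ?X) v ?C)"
    by (rule expand_step.replace) (use v fresh assms(1) in auto)
  also have "replace_by_clique (blow_up E r ?X) v ?C = blow_up E r (?X - {v} \<union> ?C)"
    by (rule replace_by_clique_blow_up) (use v fresh insert assms(4) in auto)
  finally have "expand_step (blow_up E r ?X) (blow_up E r (V - insert v D \<union> {y \<in> Y. r y \<in> insert v D}))"
    by (simp only: eq)
  with insert show ?case
    by (auto intro: rtranclp.rtrancl_into_rtrancl)
qed auto

lemma expand_steps_add_edges:
  assumes "finite F" "F \<subseteq> {{u, v} | u v. u \<in> V \<and> v \<in> V \<and> u \<noteq> v}"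
  shows "expand_step\<^sup>*\<^sup>* \<lparr>verts = V, edges = E\<rparr> \<lparr>verts = V, edges = E \<union> F\<rparr>"
  using assms
proof (induction F rule: finite_induct)
  case (insert e F)
  then have IH: "expand_step\<^sup>*\<^sup>* \<lparr>verts = V, edges = E\<rparr> \<lparr>verts = V, edges = E \<union> F\<rparr>"
    by simp
  \<comment> \<open>Rule \<open>add\<close> demands a new edge, so an edge already in
    \<open>E\<close> takes no step.\<close>
  show ?case
  proof (cases "e \<in> E")
    case True
    then show ?thesis
      using IH by (simp add: insert_absorb)
  next
    case False
    obtain u v where uv: "e = {u, v}" "u \<in> V" "v \<in> V" "u \<noteq> v"
      using insert.prems by auto
    have "expand_step \<lparr>verts = V, edges = E \<union> F\<rparr> (add_edge \<lparr>verts = V, edges = E \<union> F\<rparr> u v)"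
      by (rule expand_step.add) (use uv False insert.hyps in auto)
    then have "expand_step \<lparr>verts = V, edges = E \<union> F\<rparr> \<lparr>verts = V, edges = E \<union> insert e F\<rparr>"
      by (simp add: add_edge_def uv(1))
    with IH show ?thesis
      by (rule rtranclp.rtrancl_into_rtrancl)
  qed
qed simp

text \<open>By the contrapositive of \<open>co_hom\<close>, distinct vertices of \<open>G\<close>
  whose images coincide or are adjacent in \<open>H\<close> are adjacent in \<open>G\<close>. Hence
  blowing up \<open>H\<close> along the fibres of \<open>f\<close> creates edges of \<open>G\<close>
  only, and the remaining ones can be added.\<close>

lemma co_hom_imp_Expand:
  fixes G :: "'a ugraph" and H :: "'b ugraph"
  assumes G: "simple_graph G" and H: "simple_graph H" and f: "co_hom G H f"
  shows "G \<in> Expand H"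
proof -
  have fin: "finite (verts G)" "finite (verts H)"
    using G H by (auto simp: simple_graph_def)
  obtain p0 :: "'b \<Rightarrow> nat" where p0: "inj_on p0 (verts H)"
    using finite_imp_inj_to_nat_seg[OF fin(2)] by blast
  obtain q0 :: "'a \<Rightarrow> nat" where q0: "inj_on q0 (verts G)"
    using finite_imp_inj_to_nat_seg[OF fin(1)] by blast
  \<comment> \<open>Even names for \<open>H\<close> and odd names for \<open>G\<close> keep the
    clones disjoint from the vertices they replace.\<close>
  define p where "p x = 2 * p0 x" for x
  define q where "q x = 2 * q0 x + 1" for x
  have p: "inj_on p (verts H)" and q: "inj_on q (verts G)"
    using p0 q0 by (auto simp: p_def q_def inj_on_def)
  have pq: "p x \<noteq> q y" for x y
    unfolding p_def q_def by presburger
  define H' where "H' = copy_graph p H"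
  define G' where "G' = copy_graph q G"
  have H': "simple_graph H'" "graph_iso H H'" and G': "simple_graph G'" "graph_iso G' G"
    unfolding H'_def G'_def
    using simple_copy_graph[OF H p] graph_iso_copy_graph[OF H p] simple_copy_graph[OF G q]
      graph_iso_sym[OF graph_iso_copy_graph[OF G q]] by auto
  define V where "V = verts H'"
  define Y where "Y = verts G'"
  have V: "V = p ` verts H" and Y: "Y = q ` verts G"
    by (auto simp: V_def Y_def H'_def G'_def copy_graph_def)
  \<comment> \<open>Original vertices label themselves; the clone \<open>q u\<close> is labelled
    with the copy \<open>p (f u)\<close> of its image.\<close>
  define r where "r x = (if x \<in> V then x else p (f (inv_into (verts G) q x)))" for x
  have rq: "r (q u) = p (f u)" if "u \<in> verts G" for u
    using that q pq by (auto simp: r_def V inv_into_f_f dest: sym)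
  have fV: "f u \<in> verts H" if "u \<in> verts G" for u
    using f that by (auto simp: co_hom_def)
  have disj: "Y \<inter> V = {}"
    using pq by (auto simp: V Y dest: sym)
  have rY: "r ` Y \<subseteq> V"
    using rq fV by (auto simp: Y V)
  have rV: "r x = x" if "x \<in> V" for x
    using that by (simp add: r_def)
  have "edges (blow_up (edges H') r V) = edges H'"
  proof -
    have "edges H' \<subseteq> {{u, v} | u v. u \<in> V \<and> v \<in> V \<and> u \<noteq> v}"
      using H'(1) by (simp add: simple_graph_def V_def)
    then show ?thesis
      by (fastforce simp: blow_up_def r_def)
  qed
  then have start: "blow_up (edges H') r V = H'"
    by (simp add: blow_up_def V_def)
  \<comment> \<open>Taking \<open>D = V\<close> replaces every original vertex, so that only clones
    remain.\<close>
  have "expand_step\<^sup>*\<^sup>* (blow_up (edges H') r V)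
          (blow_up (edges H') r (V - V \<union> {y \<in> Y. r y \<in> V}))"
    by (rule expand_steps_blow_up[where Y = Y])
      (use fin disj rY rV in \<open>auto simp: V Y\<close>)
  moreover have "V - V \<union> {y \<in> Y. r y \<in> V} = Y"
    using rY by auto
  ultimately have steps: "expand_step\<^sup>*\<^sup>* H' (blow_up (edges H') r Y)"
    by (simp add: start)
  have sub: "edges (blow_up (edges H') r Y) \<subseteq> edges G'"
  proof
    fix e assume "e \<in> edges (blow_up (edges H') r Y)"
    then obtain u v where uv: "e = {q u, q v}" "u \<in> verts G" "v \<in> verts G" "q u \<noteq> q v"
        "r (q u) = r (q v) \<or> {r (q u), r (q v)} \<in> edges H'"
      by (auto simp: blow_up_def Y)
    then have "p (f u) = p (f v) \<or> {p (f u), p (f v)} \<in> edges H'"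
      by (simp add: rq)
    then have "f u = f v \<or> {f u, f v} \<in> edges H"
      using copy_graph_edge_iff[OF H p fV fV] p fV uv by (auto simp: inj_on_eq_iff H'_def)
    moreover have "u \<noteq> v"
      using uv(4) by blast
    ultimately have "{u, v} \<in> edges G"
      using co_homD[OF f uv(2,3)] by blast
    then show "e \<in> edges G'"
      using copy_graph_edge_iff[OF G q] uv by (simp add: G'_def)
  qed
  have eG: "edges G' \<subseteq> {{u, v} | u v. u \<in> Y \<and> v \<in> Y \<and> u \<noteq> v}"
    using G'(1) by (simp add: simple_graph_def Y_def)
  have "edges G' \<subseteq> Pow Y"
    using eG by auto
  then have finE: "finite (edges G')"
    using fin(1) by (simp add: Y finite_subset)
  have eq: "\<lparr>verts = Y, edges = edges G'\<rparr> = G'"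
    by (rule ugraph.equality) (simp_all add: Y_def)
  from expand_steps_add_edges[OF finE eG, of "edges (blow_up (edges H') r Y)"]
  have "expand_step\<^sup>*\<^sup>* (blow_up (edges H') r Y) G'"
    using sub eq by (simp add: blow_up_def Un_absorb1)
  with steps have "expand_step\<^sup>*\<^sup>* H' G'"
    by simp
  then show ?thesis
    using G H' G' unfolding Expand_def by blast
qed

text \<open>Mapping the \<open>i\<close>-th clique to the \<open>i\<close>-th of \<open>m\<close>
  chosen points of \<open>B\<close> works because nonadjacent vertices lie in different cliques and
  distinct points of \<open>B\<close> are nonadjacent.\<close>

lemma clique_cover_co_hom:
  assumes h: "\<And>u. u \<in> verts G \<Longrightarrow> h u < (m::nat)"
    and cliques: "\<And>u v. \<lbrakk>u \<in> verts G; v \<in> verts G; u \<noteq> v; h u = h v\<rbrakk> \<Longrightarrow> {u, v} \<in> edges G"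
    and B: "independent_set H B" "m \<le> card B"
  obtains f where "co_hom G H f"
proof -
  obtain C where C: "C \<subseteq> B" "card C = m" "finite C"
    using obtain_subset_with_card_n[OF B(2)] by blast
  then obtain b where b: "bij_betw b {0..<m} C"
    using ex_bij_betw_nat_finite by blast
  have bB: "b i \<in> B" if "i < m" for i
    using b C that by (auto simp: bij_betw_def)
  have inj: "b i \<noteq> b j" if "i < m" "j < m" "i \<noteq> j" for i j
    using b that by (auto simp: bij_betw_def inj_on_def)
  have "co_hom G H (\<lambda>u. b (h u))"
    unfolding co_hom_def
  proof (intro conjI ballI impI)
    show "(\<lambda>u. b (h u)) ` verts G \<subseteq> verts H"
      using bB h B(1) by (auto simp: independent_set_def)
    fix u v assume uv: "u \<in> verts G" "v \<in> verts G" "u \<noteq> v" "{u, v} \<notin> edges G"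
    then have "h u \<noteq> h v"
      using cliques by blast
    then show ne: "b (h u) \<noteq> b (h v)"
      using inj h uv by blast
    show "{b (h u), b (h v)} \<notin> edges H"
      using B(1) bB h uv ne by (auto simp: independent_set_def)
  qed
  then show thesis
    by (rule that)
qed

section \<open>The weak perfect graph theorem\<close>

text \<open>\<open>K\<close> is a maximum clique of the induced subgraph; by perfection its size is
  the least number of colours.\<close>

lemma perfect_colouring:
  assumes G: "simple_graph G" and "perfect G" and U: "U \<subseteq> verts G"
  obtains K f where "clique G K" "K \<subseteq> U" "f ` U \<subseteq> {..<card K}"
    "\<And>u v. u \<in> U \<Longrightarrow> v \<in> U \<Longrightarrow> {u, v} \<in> edges G \<Longrightarrow> f u \<noteq> f v"
proof -
  let ?I = "induced_subgraph G U"
  have fin: "finite U"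
    using G U by (auto simp: simple_graph_def finite_subset)
  have I: "verts ?I = U" "\<And>u v. {u, v} \<in> edges ?I \<longleftrightarrow> {u, v} \<in> edges G \<and> u \<in> U \<and> v \<in> U"
    by (auto simp: induced_subgraph_def)
  obtain g :: "_ \<Rightarrow> nat" and n where g: "g ` U = {i. i < n}" "inj_on g U"
    using finite_imp_inj_to_nat_seg[OF fin] by blast
  \<comment> \<open>An injective numbering is a proper colouring, so the \<open>LEAST\<close> in
    \<open>chromatic_number\<close> is attained.\<close>
  have "colourable ?I n"
    unfolding colourable_def I
    by (rule exI[of _ g]) (use g edge_in_vertsD(3)[OF G] in \<open>auto simp: inj_on_eq_iff\<close>)
  then have col: "colourable ?I (chromatic_number ?I)"
    unfolding chromatic_number_def by (rule LeastI)
  have "clique_number ?I \<in> {card C | C. clique ?I C}"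
    unfolding clique_number_def
  proof (rule Max_in)
    show "finite {card C | C. clique ?I C}"
      by (rule finite_subset[of _ "card ` Pow U"]) (use fin in \<open>auto simp: clique_def I\<close>)
    have "clique ?I {}"
      by (simp add: clique_def)
    then show "{card C | C. clique ?I C} \<noteq> {}"
      by blast
  qed
  then obtain K where K: "clique ?I K" "card K = clique_number ?I"
    by auto
  have "clique G K" "K \<subseteq> U"
    using K(1) U by (auto simp: clique_def I)
  moreover have "card K = chromatic_number ?I"
    using K(2) assms(2) U by (simp add: perfect_def)
  ultimately show thesis
    using col that[of K] unfolding colourable_def I by auto
qed

section \<open>Replication and weighted colourings\<close>

lemma card_clique_Int_independent_set:
  assumes "finite K" "clique G K" "independent_set G A"
  shows "card (K \<inter> A) \<le> 1"
proof -
  have "\<And>x y. x \<in> K \<inter> A \<Longrightarrow> y \<in> K \<inter> A \<Longrightarrow> x = y"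
    using assms unfolding clique_def independent_set_def by blast
  then show ?thesis
    using assms(1) by (simp add: card_le_Suc0_iff_eq)
qed

text \<open>Lovasz's replication lemma in weighted form: \<^term>\<open>k x\<close> counts the clones of \<^term>\<open>x\<close>,
  and each \<^term>\<open>A j\<close> is a colour class of the replicated graph.\<close>

lemma perfect_weighted_colouring:
  fixes k :: "'a \<Rightarrow> nat"
  assumes G: "simple_graph G" and perf: "perfect G"
  shows "\<exists>(A :: nat \<Rightarrow> 'a set) m K. (\<forall>j<m. independent_set G (A j)) \<and>
    (\<forall>y\<in>verts G. (\<Sum>j<m. of_bool (y \<in> A j)) = k y) \<and> clique G K \<and> m \<le> sum k K"
proof (induction "sum k (verts G)" arbitrary: k rule: less_induct)
  case less
  have fin: "finite (verts G)"
    using G by (simp add: simple_graph_def)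
  have finK: "finite K" if "clique G K" for K
    using that fin by (auto simp: clique_def finite_subset)
  show ?case
  proof (cases "\<forall>x\<in>verts G. k x \<le> 1")
    case True
    \<comment> \<open>All weights are 0 or 1 here, so a colouring of the subgraph induced on the
      support suffices.\<close>
    define U where "U = {x \<in> verts G. k x = 1}"
    obtain K f where K: "clique G K" "K \<subseteq> U" and f: "f ` U \<subseteq> {..<card K}"
        "\<And>u v. u \<in> U \<Longrightarrow> v \<in> U \<Longrightarrow> {u, v} \<in> edges G \<Longrightarrow> f u \<noteq> f v"
      by (rule perfect_colouring[OF G perf, of U]) (auto simp: U_def)
    define A where "A j = {u \<in> U. f u = j}" for j
    have "independent_set G (A j)" for j
      unfolding independent_set_def
    proof (intro conjI ballI impI)
      show "A j \<subseteq> verts G"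
        by (auto simp: A_def U_def)
      show "{u, v} \<notin> edges G" if "u \<in> A j" "v \<in> A j" for u v
        using f(2)[of u v] that by (auto simp: A_def)
    qed
    moreover have "(\<Sum>j<card K. of_bool (y \<in> A j)) = k y" if "y \<in> verts G" for y
    proof (cases "y \<in> U")
      case True
      then have "{..<card K} \<inter> {j. y \<in> A j} = {f y}"
        using f(1) by (auto simp: A_def)
      then show ?thesis
        using True by (simp add: sum_of_bool_eq U_def)
    next
      case False
      then have "k y = 0"
        using \<open>\<forall>x\<in>verts G. k x \<le> 1\<close> that by (auto simp: U_def le_Suc_eq)
      then show ?thesis
        using False by (simp add: A_def)
    qed
    moreover have "card K \<le> sum k K"
    proof -
      have "sum k K = (\<Sum>x\<in>K. 1)"
        by (rule sum.cong) (use K in \<open>auto simp: U_def\<close>)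
      then show ?thesis
        by simp
    qed
    ultimately show ?thesis
      using K(1) by blast
  next
    case False
    then obtain x where x: "x \<in> verts G" "2 \<le> k x"
      by force
    \<comment> \<open>One clone of \<open>x\<close> is taken away, and the rest is coloured by
      induction.\<close>
    define k' where "k' = k(x := k x - 1)"
    have k'le: "k' y \<le> k y" for y
      by (simp add: k'_def)
    have sum': "sum k' (verts G) < sum k (verts G)"
      by (rule sum_strict_mono_ex1) (use fin x k'le in \<open>auto simp: k'_def intro!: bexI[of _ x]\<close>)
    from less[OF this] obtain A m K where A: "\<And>j. j < m \<Longrightarrow> independent_set G (A j)"
        and Ak: "\<And>y. y \<in> verts G \<Longrightarrow> (\<Sum>j<m. of_bool (y \<in> A j)) = k' y"
        and K: "clique G K" "m \<le> sum k' K"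
      by blast
    have extend: "(\<Sum>j<Suc n. of_bool (y \<in> (B(n := C)) j)) =
        (\<Sum>j<n. of_bool (y \<in> B j)) + (of_bool (y \<in> C) :: nat)" for B :: "nat \<Rightarrow> 'a set" and n C y
      by simp
    \<comment> \<open>If a clique through \<open>x\<close> already has weight at least
      \<open>m\<close>, the restored clone raises its weight by one, which pays for a new colour
      class \<open>{x}\<close>. Otherwise the colouring is rearranged to save a class.\<close>
    show ?thesis
    proof (cases "\<exists>L. clique G L \<and> x \<in> L \<and> m \<le> sum k' L")
      case True
      then obtain L where L: "clique G L" "x \<in> L" "m \<le> sum k' L"
        by blast
      have "sum k' L < sum k L"
        by (rule sum_strict_mono_ex1) (use finK L x k'le in \<open>auto simp: k'_def intro!: bexI[of _ x]\<close>)
      then have "Suc m \<le> sum k L"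
        using L by simp
      moreover have "\<forall>j<Suc m. independent_set G ((A(m := {x})) j)"
        using A x by (auto simp: less_Suc_eq independent_set_def)
      moreover have "\<forall>y\<in>verts G. (\<Sum>j<Suc m. of_bool (y \<in> (A(m := {x})) j)) = k y"
        using x Ak by (auto simp only: extend) (auto simp: k'_def)
      ultimately show ?thesis
        using L(1) by blast
    next
      case False
      \<comment> \<open>\<open>2 \<le> k x\<close> keeps \<open>k' x\<close> positive, so
        \<open>x\<close> lies in some colour class.\<close>
      have "(\<Sum>j<m. of_bool (x \<in> A j)) \<noteq> (0::nat)"
        using Ak[OF x(1)] x by (simp add: k'_def)
      then obtain i where i: "i < m" "x \<in> A i"
        by (auto simp: sum_eq_0_iff)
      \<comment> \<open>The class \<open>A i\<close> is taken out except at \<open>x\<close>. Adding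
        it back in full as a colour class restores \<open>k\<close>, including the clone of
        \<open>x\<close> that \<open>k'\<close> lacks.\<close>
      define k'' where "k'' y = (if y \<in> A i - {x} then k' y - 1 else k' y)" for y
      have k''le: "k'' y \<le> k' y" for y
        by (simp add: k''_def)
      have k'pos: "k' y \<ge> 1" if "y \<in> A i" for y
      proof -
        have y: "y \<in> verts G"
          using A[OF i(1)] that by (auto simp: independent_set_def)
        have "(of_bool (y \<in> A i) :: nat) \<le> (\<Sum>j<m. of_bool (y \<in> A j))"
          using i by (intro member_le_sum) auto
        then show ?thesis
          using that Ak[OF y] by simp
      qed
      have "sum k'' (verts G) \<le> sum k' (verts G)"
        by (intro sum_mono k''le)
      with sum' have "sum k'' (verts G) < sum k (verts G)"
        by simp
      from less[OF this] obtain B n L where B: "\<And>j. j < n \<Longrightarrow> independent_set G (B j)"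
          and Bk: "\<And>y. y \<in> verts G \<Longrightarrow> (\<Sum>j<n. of_bool (y \<in> B j)) = k'' y"
          and L: "clique G L" "n \<le> sum k'' L"
        by blast
      have LV: "L \<subseteq> verts G"
        using L by (simp add: clique_def)
      have cnt: "sum k' L = (\<Sum>j<m. card (L \<inter> A j))"
      proof -
        have "sum k' L = (\<Sum>y\<in>L. \<Sum>j<m. of_bool (y \<in> A j))"
          by (rule sum.cong) (use LV Ak in auto)
        also have "\<dots> = (\<Sum>j<m. \<Sum>y\<in>L. of_bool (y \<in> A j))"
          by (rule sum.swap)
        also have "\<dots> = (\<Sum>j<m. card (L \<inter> A j))"
          by (rule sum.cong) (use finK[OF L(1)] in \<open>auto simp: sum_of_bool_eq\<close>)
        finally show ?thesis .
      qed
      have le1: "card (L \<inter> A j) \<le> 1" if "j < m" for j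
        using card_clique_Int_independent_set[OF finK[OF L(1)] L(1) A[OF that]] .
      \<comment> \<open>A clique meets each of the \<open>m\<close> classes at most once, so
        \<open>sum k' L \<le> m\<close>. This is strict if \<open>L\<close> misses
        \<open>A i\<close> or contains \<open>x\<close>; otherwise \<open>L\<close> meets
        \<open>A i\<close> outside \<open>x\<close>, where \<open>k''\<close> is below
        \<open>k'\<close>.\<close>
      have "n < m"
      proof (cases "L \<inter> A i = {}")
        case True
        have "(\<Sum>j<m. card (L \<inter> A j)) < (\<Sum>j<m. 1)"
          by (rule sum_strict_mono_ex1) (use le1 True i in \<open>auto intro!: bexI[of _ i]\<close>)
        then have "sum k' L < m"
          using cnt by simp
        moreover have "sum k'' L \<le> sum k' L"
          by (intro sum_mono k''le)
        ultimately show ?thesis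
          using L(2) by simp
      next
        case ne: False
        have le: "sum k' L \<le> m"
          using sum_mono[of "{..<m}" "\<lambda>j. card (L \<inter> A j)" "\<lambda>_. 1"] le1 cnt by simp
        show ?thesis
        proof (cases "x \<in> L")
          case True
          then have "sum k' L < m"
            using False L(1) by force
          moreover have "sum k'' L \<le> sum k' L"
            by (intro sum_mono k''le)
          ultimately show ?thesis
            using L(2) by simp
        next
          case xL: False
          from ne obtain y where y: "y \<in> L" "y \<in> A i"
            by auto
          with xL have "y \<noteq> x"
            by auto
          then have "k'' y < k' y"
            using y k'pos[of y] by (simp add: k''_def)
          then have "sum k'' L < sum k' L"
            by (intro sum_strict_mono_ex1) (use finK L k''le y in auto)
          then show ?thesis
            using le L(2) by simp
        qed
      qed
      have "\<forall>j<Suc n. independent_set G ((B(n := A i)) j)"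
        using A[OF i(1)] B by (auto simp: less_Suc_eq)
      moreover have "(\<Sum>j<Suc n. of_bool (y \<in> (B(n := A i)) j)) = k y" if "y \<in> verts G" for y
      proof -
        have "(\<Sum>j<Suc n. of_bool (y \<in> (B(n := A i)) j)) = k'' y + of_bool (y \<in> A i)"
          using Bk[OF that] by (simp only: extend)
        also have "\<dots> = k y"
          using k'pos[of y] i(2) x by (auto simp: k''_def k'_def)
        finally show ?thesis .
      qed
      \<comment> \<open>The clique found for \<open>k'\<close> serves again, as
        \<open>Suc n \<le> m\<close>.\<close>
      moreover have "Suc n \<le> sum k K"
        using K(2) \<open>n < m\<close> sum_mono[of K k' k, OF k'le] by linarith
      ultimately show ?thesis
        using K(1) by blast
    qed
  qed
qed

text \<open>Suppose each clique \<open>K\<close> in \<open>U\<close> misses some independent set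
  \<open>S K\<close> of size \<open>a\<close>, and weight each vertex by the number of sets
  \<open>S K\<close> containing it. The weighted colouring then has fewer classes than there are
  cliques in \<open>U\<close>, yet classes with at most \<open>a\<close> vertices in
  \<open>U\<close> must supply a weight of \<open>a\<close> per clique.\<close>

lemma perfect_clique_meets_maximum_independent_sets:
  assumes G: "simple_graph G" and perf: "perfect G" and U: "U \<subseteq> verts G"
    and bound: "\<And>A. independent_set G A \<Longrightarrow> A \<subseteq> U \<Longrightarrow> card A \<le> a" and a: "0 < a"
  obtains K where "clique G K" "K \<subseteq> U"
    "\<And>A. independent_set G A \<Longrightarrow> A \<subseteq> U \<Longrightarrow> card A = a \<Longrightarrow> K \<inter> A \<noteq> {}"
proof (rule ccontr)
  assume "\<not> thesis"
  then have no_K: "\<not> (clique G K \<and> K \<subseteq> U \<and>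
      (\<forall>A. independent_set G A \<and> A \<subseteq> U \<and> card A = a \<longrightarrow> K \<inter> A \<noteq> {}))" for K
    using that[of K] by blast
  define \<K> where "\<K> = {K. clique G K \<and> K \<subseteq> U}"
  have "\<exists>A. independent_set G A \<and> A \<subseteq> U \<and> card A = a \<and> K \<inter> A = {}" if "K \<in> \<K>" for K
    using that no_K[of K] unfolding \<K>_def by blast
  then obtain S where S: "\<And>K. K \<in> \<K> \<Longrightarrow>
      independent_set G (S K) \<and> S K \<subseteq> U \<and> card (S K) = a \<and> K \<inter> S K = {}"
    by metis
  have finU: "finite U"
    using G U by (auto simp: simple_graph_def finite_subset)
  have fin\<K>: "finite \<K>"
    by (rule finite_subset[of _ "Pow U"]) (use finU in \<open>auto simp: \<K>_def\<close>)
  define k :: "_ \<Rightarrow> nat" where "k y = (\<Sum>K\<in>\<K>. of_bool (y \<in> S K))" for y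
  have sumk: "sum k X = (\<Sum>K\<in>\<K>. card (X \<inter> S K))" if "finite X" for X
    unfolding k_def by (subst sum.swap) (use that in \<open>simp add: sum_of_bool_eq\<close>)
  obtain A m L where A: "\<And>j. j < m \<Longrightarrow> independent_set G (A j)"
      and Ak: "\<And>y. y \<in> verts G \<Longrightarrow> (\<Sum>j<m. of_bool (y \<in> A j)) = k y"
      and L: "clique G L" "m \<le> sum k L"
    using perfect_weighted_colouring[OF G perf, of k] by blast
  have finL: "finite L"
    using L(1) G by (auto simp: clique_def simple_graph_def finite_subset)
  \<comment> \<open>\<open>L\<close> may leave \<open>U\<close>, but the sets \<open>S K\<close> lie
    in \<open>U\<close>, so the one missed by \<open>L \<inter> U\<close> is missed by
    \<open>L\<close> as well.\<close>
  have LU: "L \<inter> U \<in> \<K>"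
    using L(1) by (auto simp: \<K>_def clique_def)
  have "(\<Sum>K\<in>\<K>. card (L \<inter> S K)) < (\<Sum>K\<in>\<K>. 1)"
  proof (rule sum_strict_mono_ex1)
    show "\<forall>K\<in>\<K>. card (L \<inter> S K) \<le> 1"
      using S card_clique_Int_independent_set[OF finL L(1)] by blast
    have "L \<inter> S (L \<inter> U) = {}"
      using S[OF LU] by blast
    then show "\<exists>K\<in>\<K>. card (L \<inter> S K) < 1"
      using LU by (intro bexI[of _ "L \<inter> U"]) auto
  qed (rule fin\<K>)
  with sumk[OF finL] L(2) have m: "m < card \<K>"
    by simp
  \<comment> \<open>Double counting of the weight on \<open>U\<close>, first by cliques, then by
    colour classes.\<close>
  have "a * card \<K> = (\<Sum>K\<in>\<K>. card (U \<inter> S K))"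
  proof -
    have "(\<Sum>K\<in>\<K>. card (U \<inter> S K)) = (\<Sum>K\<in>\<K>. a)"
      by (rule sum.cong) (use S in \<open>auto simp: Int_absorb1\<close>)
    then show ?thesis
      by simp
  qed
  also have "\<dots> = sum k U"
    using sumk[OF finU] by simp
  also have "\<dots> = (\<Sum>y\<in>U. \<Sum>j<m. of_bool (y \<in> A j))"
    by (rule sum.cong) (use Ak U in auto)
  also have "\<dots> = (\<Sum>j<m. card (U \<inter> A j))"
    by (subst sum.swap) (simp add: sum_of_bool_eq finU)
  also have "\<dots> \<le> (\<Sum>j<m. a)"
  proof (rule sum_mono)
    fix j assume "j \<in> {..<m}"
    then have "independent_set G (U \<inter> A j)"
      using A[of j] by (auto simp: independent_set_def)
    then show "card (U \<inter> A j) \<le> a"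
      by (rule bound) auto
  qed
  also have "\<dots> = a * m"
    by simp
  finally show False
    using m a by simp
qed

text \<open>Removing a clique that meets all independent sets of the largest permitted size lowers
  the bound by one; in the induction this clique receives the new number \<open>a\<close>.\<close>

lemma perfect_clique_cover:
  assumes G: "simple_graph G" and perf: "perfect G" and "U \<subseteq> verts G"
    and "\<And>A. independent_set G A \<Longrightarrow> A \<subseteq> U \<Longrightarrow> card A \<le> a"
  shows "\<exists>h :: 'a \<Rightarrow> nat. (\<forall>u\<in>U. h u < a) \<and>
           (\<forall>u\<in>U. \<forall>v\<in>U. u \<noteq> v \<longrightarrow> h u = h v \<longrightarrow> {u, v} \<in> edges G)"
  using assms(3,4)
proof (induction a arbitrary: U)
  case 0
  have "U = {}"
  proof (rule ccontr)
    assume "U \<noteq> {}"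
    then obtain u where "u \<in> U"
      by blast
    with 0 have "card {u} \<le> 0"
      by (intro 0(2)) (auto simp: independent_set_def)
    then show False
      by simp
  qed
  then show ?case
    by simp
next
  case (Suc a)
  obtain K where K: "clique G K" "K \<subseteq> U"
      "\<And>A. independent_set G A \<Longrightarrow> A \<subseteq> U \<Longrightarrow> card A = Suc a \<Longrightarrow> K \<inter> A \<noteq> {}"
    by (rule perfect_clique_meets_maximum_independent_sets[OF G perf Suc.prems]) auto
  have "card A \<le> a" if "independent_set G A" "A \<subseteq> U - K" for A
  proof -
    have "card A \<noteq> Suc a"
      using K(3)[of A] that by blast
    then show ?thesis
      using Suc.prems(2)[of A] that by force
  qed
  with Suc.IH[of "U - K"] Suc.prems(1) obtain h where h: "\<forall>u\<in>U - K. h u < a"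
      "\<forall>u\<in>U - K. \<forall>v\<in>U - K. u \<noteq> v \<longrightarrow> h u = h v \<longrightarrow> {u, v} \<in> edges G"
    by blast
  let ?h = "\<lambda>u. if u \<in> K then a else h u"
  have "{u, v} \<in> edges G" if "u \<in> U" "v \<in> U" "u \<noteq> v" "?h u = ?h v" for u v
  proof (cases "u \<in> K"; cases "v \<in> K")
    assume "u \<in> K" "v \<in> K"
    then show ?thesis
      using K(1) that(3) unfolding clique_def by blast
  next
    assume "u \<notin> K" "v \<notin> K"
    then show ?thesis
      using h(2) that by simp
  qed (use h(1) that in force)+
  moreover have "?h u < Suc a" if "u \<in> U" for u
    using h(1) that by (simp add: less_Suc_eq)
  ultimately show ?case
    by (intro exI[of _ ?h]) blast
qed

lemma perfect_co_hom:
  assumes G: "simple_graph G" and H: "simple_graph H" and le: "alpha_star G H \<le> 1"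
    and perf: "perfect G"
  obtains f where "co_hom G H f"
proof -
  have fin: "finite (verts G)" "finite (verts H)"
    using G H by (auto simp: simple_graph_def)
  obtain A where A: "independent_set G A" "card A = independence_number G"
    by (rule independence_number_attained[OF fin(1)])
  obtain B where B: "independent_set H B" "card A \<le> card B"
    by (rule dominated_independent_set[OF fin le A(1)])
  obtain h :: "_ \<Rightarrow> nat" where "\<forall>u\<in>verts G. h u < card A"
      "\<forall>u\<in>verts G. \<forall>v\<in>verts G. u \<noteq> v \<longrightarrow> h u = h v \<longrightarrow> {u, v} \<in> edges G"
    using perfect_clique_cover[OF G perf subset_refl, of "card A"]
      card_le_independence_number[OF fin(1)] A(2) by auto
  then show thesis
    using clique_cover_co_hom[of G h "card A" H B] B that by blast
qed

section \<open>Powers of cycles\<close>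

text \<open>Adjacency would make \<open>n\<close> divide \<open>d - j\<close> or
  \<open>d + j\<close> for some \<open>j\<close> between 1 and \<open>k\<close>, but the bounds on
  \<open>d\<close> put both strictly between 0 and \<open>n\<close>.\<close>

lemma cayley_cyclic_nonadjacent:
  assumes "[a - b = d] (mod int n)" "int k < d" "d < int n - int k"
  shows "a \<noteq> b" "{a, b} \<notin> edges (cayley_cyclic n k)"
proof -
  have small: "\<not> int n dvd e" if "0 < e" "e < int n" for e
    using that zdvd_not_zless by blast
  have d: "int n dvd a - b - d"
    using assms(1) by (simp add: cong_iff_dvd_diff)
  show "a \<noteq> b"
    using d small[of d] assms(2,3) by auto
  show "{a, b} \<notin> edges (cayley_cyclic n k)"
  proof
    assume "{a, b} \<in> edges (cayley_cyclic n k)"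
    then obtain a' b' j where ab: "{a, b} = {a', b'}" and j: "1 \<le> j" "j \<le> int k"
        "[a' - b' = j] (mod int n) \<or> [a' - b' = - j] (mod int n)"
      unfolding cayley_cyclic_def by auto
    have dvd_j: "int n dvd a' - b' - j \<or> int n dvd a' - b' + j"
      using j(3) by (auto simp: cong_iff_dvd_diff)
    have "a = a' \<and> b = b' \<or> a = b' \<and> b = a'"
      using ab by (auto simp: doubleton_eq_iff)
    then have "int n dvd a - b - j \<or> int n dvd a - b + j"
    proof
      assume "a = b' \<and> b = a'"
      moreover have "int n dvd - (a' - b' - j) \<or> int n dvd - (a' - b' + j)"
        using dvd_j by (simp only: dvd_minus_iff)
      ultimately show ?thesis
        by (simp add: algebra_simps) blast
    qed (use dvd_j in auto)
    then have "int n dvd d - j \<or> int n dvd d + j"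
    proof
      assume "int n dvd a - b - j"
      from dvd_diff[OF this d] show ?thesis
        by simp
    next
      assume "int n dvd a - b + j"
      from dvd_diff[OF this d] show ?thesis
        by (simp add: algebra_simps)
    qed
    then show False
      using small[of "d - j"] small[of "d + j"] assms(2,3) j by auto
  qed
qed

text \<open>Blocks of \<open>k + 1\<close> consecutive integers are the cliques of the covers: two
  members of a block differ by at most \<open>k\<close>.\<close>

lemma cayley_cyclic_adjacent:
  assumes "a \<in> {0..<int n}" "b \<in> {0..<int n}" "a \<noteq> b" "a div (int k + 1) = b div (int k + 1)"
  shows "{a, b} \<in> edges (cayley_cyclic n k)"
proof -
  have "a - b = a mod (int k + 1) - b mod (int k + 1)"
    using assms(4) by (metis add_diff_cancel_left div_mult_mod_eq)
  moreover have "0 \<le> a mod (int k + 1)" "a mod (int k + 1) < int k + 1"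
      "0 \<le> b mod (int k + 1)" "b mod (int k + 1) < int k + 1"
    by (rule pos_mod_bound pos_mod_sign; simp)+
  ultimately have "\<bar>a - b\<bar> \<le> int k"
    by linarith
  with assms(3) have "\<bar>a - b\<bar> \<in> {1..int k}"
    by simp
  moreover have "a - b = \<bar>a - b\<bar> \<or> a - b = - \<bar>a - b\<bar>"
    by linarith
  ultimately have "\<exists>j\<in>{1..int k}. [a - b = j] (mod int n) \<or> [a - b = - j] (mod int n)"
    by (metis cong_refl)
  then show ?thesis
    using assms unfolding cayley_cyclic_def by auto
qed

section \<open>Sums along progressions of residues\<close>

lemma sum_rotate_int:
  fixes g :: "int \<Rightarrow> nat"
  assumes "0 < n"
  shows "(\<Sum>i\<in>{0..<n}. g ((i + d) mod n)) = (\<Sum>i\<in>{0..<n}. g i)"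
  by (rule sum.reindex_bij_witness[of _ "\<lambda>i. (i - d) mod n" "\<lambda>i. (i + d) mod n"])
    (use assms in \<open>auto simp: mod_simps\<close>)

text \<open>Over a period the progression sums average at least \<open>d\<close>, so the upper bound
  forces all of them to equal \<open>d\<close>. Since \<open>int d * l\<close> is -1 modulo
  \<open>N\<close>, comparing the sums starting at \<open>i\<close> and \<open>i + l\<close> shows
  that \<open>s\<close> is constant, and the total excludes the constant 0.\<close>

lemma progression_sums_le_imp_pos:
  fixes s :: "int \<Rightarrow> nat"
  assumes Nl: "N = int d * l + 1" and N: "0 < N"
    and s_mod: "\<And>i. s (i mod N) = s i"
    and total: "nat N \<le> (\<Sum>i\<in>{0..<N}. s i)"
    and le: "\<And>i. (\<Sum>t<d. s (i + int t * l)) \<le> d"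
  shows "0 < s i"
proof -
  define w where "w i = (\<Sum>t<d. s (i + int t * l))" for i
  have w_le: "w i \<le> d" for i
    using le by (simp add: w_def)
  \<comment> \<open>For each fixed \<open>t\<close>, the shifted values run through a full period
    and contribute the whole total.\<close>
  have "(\<Sum>i\<in>{0..<N}. w i) = (\<Sum>t<d. \<Sum>i\<in>{0..<N}. s ((i + int t * l) mod N))"
    unfolding w_def s_mod by (rule sum.swap)
  also have "\<dots> = d * (\<Sum>i\<in>{0..<N}. s i)"
    by (simp add: sum_rotate_int[OF N])
  finally have w_sum: "(\<Sum>i\<in>{0..<N}. w i) = d * (\<Sum>i\<in>{0..<N}. s i)" .
  have w_eq: "w i = d" if "i \<in> {0..<N}" for i
  proof (rule ccontr)
    assume "w i \<noteq> d"
    then have "w i < d"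
      using w_le[of i] by simp
    then have "(\<Sum>i\<in>{0..<N}. w i) < (\<Sum>i\<in>{0..<N}. d)"
      by (intro sum_strict_mono_ex1) (use w_le that in auto)
    also have "\<dots> = d * nat N"
      by simp
    also have "\<dots> \<le> d * (\<Sum>i\<in>{0..<N}. s i)"
      using total by simp
    finally show False
      using w_sum by simp
  qed
  \<comment> \<open>Periodicity extends the equality to all integers, since \<open>i + l\<close> may
    leave the range.\<close>
  have w_mod: "w (i mod N) = w i" for i
    unfolding w_def
    by (rule sum.cong) (auto simp: s_mod[symmetric, of "_ mod _ + _"] mod_simps s_mod)
  have w_const: "w i = d" for i
    using w_eq[of "i mod N"] w_mod N by simp
  \<comment> \<open>Shifting the progression by \<^term>\<open>l\<close> exchanges its first term for \<open>i + int d * l = i - 1\<close> modulo \<^term>\<open>N\<close>.\<close>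
  have shift: "s i = s (i - 1)" for i
  proof -
    have "w (i + l) + s i = (\<Sum>t<d. s (i + int (Suc t) * l)) + s (i + int 0 * l)"
      by (simp add: w_def algebra_simps)
    also have "\<dots> = (\<Sum>t<Suc d. s (i + int t * l))"
      by (subst sum.lessThan_Suc_shift) simp
    also have "\<dots> = w i + s (i + int d * l)"
      by (simp add: w_def)
    finally have "s i = s (i + int d * l)"
      by (simp add: w_const)
    also have "\<dots> = s ((i - 1 + N) mod N)"
      unfolding s_mod using Nl by (simp add: algebra_simps)
    also have "\<dots> = s (i - 1)"
      by (simp add: s_mod)
    finally show ?thesis .
  qed
  have const: "s (int j) = s 0" for j
    by (induction j) (use shift[of "1 + int _"] in simp_all)
  have const_nonneg: "s i = s 0" if "0 \<le> i" for i
    using const[of "nat i"] that by simp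
  have "(\<Sum>i\<in>{0..<N}. s i) = (\<Sum>i\<in>{0..<N}. s 0)"
    by (intro sum.cong const_nonneg) auto
  then have "nat N \<le> nat N * s 0"
    using total by simp
  then have "0 < s 0"
    using N by (cases "s 0") auto
  then show ?thesis
    using const_nonneg[of "i mod N"] s_mod[of i] N by simp
qed

lemma cayley_cyclic_co_hom:
  fixes G :: "'a ugraph" and H :: "'b ugraph"
  assumes G: "simple_graph G" and H: "simple_graph H" and le: "alpha_star G H \<le> 1"
    and n: "n \<ge> 1" and nc: "int n = c * (int k + 1) + 1 \<or> int n = c * (int k + 1)"
    and iso: "graph_iso G (cayley_cyclic n k)"
  obtains f where "co_hom G H f"
proof -
  note found = that
  define N where "N = int n"
  define l where "l = int k + 1"
  have N: "0 < N" and l: "0 < l"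
    using n by (auto simp: N_def l_def)
  have fin: "finite (verts G)" "finite (verts H)"
    using G H by (auto simp: simple_graph_def)
  have vC: "verts (cayley_cyclic n k) = {0..<N}"
    by (simp add: cayley_cyclic_def N_def)
  obtain \<phi> where \<phi>: "bij_betw \<phi> (verts G) {0..<N}"
      "\<And>u v. u \<in> verts G \<Longrightarrow> v \<in> verts G \<Longrightarrow>
         {u, v} \<in> edges G \<longleftrightarrow> {\<phi> u, \<phi> v} \<in> edges (cayley_cyclic n k)"
    using iso by (auto simp: graph_iso_def vC)
  have \<phi>N: "\<phi> u \<in> {0..<N}" if "u \<in> verts G" for u
    using \<phi>(1) that by (auto simp: bij_betw_def)
  \<comment> \<open>The inverse of \<open>\<phi>\<close> is extended periodically to all integers,
    so that progressions may run past \<open>N\<close>.\<close>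
  define \<psi> where "\<psi> i = inv_into (verts G) \<phi> (i mod N)" for i
  have \<psi>: "\<psi> i \<in> verts G" "\<phi> (\<psi> i) = i mod N" for i
  proof -
    have "i mod N \<in> \<phi> ` verts G"
      using \<phi>(1) N by (auto simp: bij_betw_def)
    then show "\<psi> i \<in> verts G" "\<phi> (\<psi> i) = i mod N"
      by (auto simp: \<psi>_def inv_into_into f_inv_into_f)
  qed
  \<comment> \<open>The bounds say that \<open>i\<close> and \<open>j\<close> are at least
    \<open>l\<close> apart in both directions around the cycle.\<close>
  have \<psi>_nonadj: "\<psi> i \<noteq> \<psi> j \<and> {\<psi> i, \<psi> j} \<notin> edges G" if "l \<le> i - j" "i - j \<le> N - l" for i j
  proof -
    have "[i mod N - j mod N = i - j] (mod int n)"
      by (simp add: cong_def N_def mod_simps)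
    moreover have "int k < i - j" "i - j < int n - int k"
      using that by (simp_all add: N_def l_def)
    ultimately have "i mod N \<noteq> j mod N" "{i mod N, j mod N} \<notin> edges (cayley_cyclic n k)"
      by (rule cayley_cyclic_nonadjacent)+
    then show ?thesis
      using \<phi>(2)[OF \<psi>(1)[of i] \<psi>(1)[of j]] \<psi>(2)[of i] \<psi>(2)[of j] by metis
  qed
  have div_less: "a div l < e" if "a < e * l" for a e
  proof (rule ccontr)
    assume "\<not> a div l < e"
    then have "e * l \<le> a div l * l"
      using l by (intro mult_right_mono) auto
    moreover have "a div l * l \<le> a"
      using div_mult_mod_eq[of a l] pos_mod_sign[OF l, of a] by linarith
    ultimately show False
      using that by simp
  qed
  \<comment> \<open>Cutting the residues into blocks of length \<open>l\<close>, the last one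
    possibly shorter, gives at most \<open>m\<close> cliques.\<close>
  have cover: thesis if h: "\<And>a. a \<in> {0..<N} \<Longrightarrow> a div l < m" and
      B: "independent_set H B" "m \<le> int (card B)" for m B
  proof -
    have pos: "0 \<le> \<phi> u div l" if "u \<in> verts G" for u
      using \<phi>N[OF that] l by (simp add: pos_imp_zdiv_nonneg_iff)
    have "\<And>u. u \<in> verts G \<Longrightarrow> nat (\<phi> u div l) < card B"
      using h \<phi>N B(2) pos by (smt (verit) nat_less_iff)
    moreover have "{u, v} \<in> edges G"
      if "u \<in> verts G" "v \<in> verts G" "u \<noteq> v" "nat (\<phi> u div l) = nat (\<phi> v div l)" for u v
    proof -
      have "\<phi> u \<noteq> \<phi> v"
        using \<phi>(1) that by (auto simp: bij_betw_def inj_on_eq_iff)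
      moreover have "\<phi> u div l = \<phi> v div l"
        using that pos by (simp add: nat_eq_iff)
      ultimately show ?thesis
        using cayley_cyclic_adjacent[of "\<phi> u" n "\<phi> v" k] \<phi>N \<phi>(2) that
        by (simp add: N_def l_def)
    qed
    ultimately show thesis
      using clique_cover_co_hom[of G "\<lambda>u. nat (\<phi> u div l)" "card B" H B] B(1) found
      by blast
  qed
  \<comment> \<open>A negative \<open>c\<close> would give \<open>c * l + 1 \<le> 0\<close>, and
    \<open>c = 0\<close> leaves a single vertex.\<close>
  consider (mult) "N = c * l" | (zero) "N = 1" "c = 0" | (succ) "N = c * l + 1" "1 \<le> c"
  proof -
    have "0 \<le> c" if "N = c * l + 1"
    proof (rule ccontr)
      assume "\<not> 0 \<le> c"
      then have "c * l \<le> - 1 * l"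
        using l by (intro mult_right_mono) auto
      then show False
        using that N l by simp
    qed
    then show ?thesis
      using nc that unfolding N_def l_def by (cases "c = 0") auto
  qed
  then show thesis
  proof cases
    case mult
    have c: "0 < c"
      using mult N l by (simp add: zero_less_mult_iff)
    \<comment> \<open>The multiples of \<open>l\<close> are pairwise nonadjacent, as their largest
      gap \<open>(c - 1) * l\<close> is exactly \<open>N - l\<close>; there are as many of them as
      blocks.\<close>
    let ?A = "(\<lambda>t. \<psi> (t * l)) ` {0..<c}"
    have nonadj: "\<psi> (t * l) \<noteq> \<psi> (s * l) \<and> {\<psi> (t * l), \<psi> (s * l)} \<notin> edges G"
      if "s \<in> {0..<c}" "t \<in> {0..<c}" "s < t" for s t
    proof -
      have "1 * l \<le> (t - s) * l" "(t - s) * l \<le> (c - 1) * l"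
        using that l by (auto intro!: mult_right_mono)
      then show ?thesis
        using mult by (intro \<psi>_nonadj) (auto simp: algebra_simps)
    qed
    have "inj_on (\<lambda>t. \<psi> (t * l)) {0..<c}"
      by (rule linorder_inj_onI) (use nonadj in \<open>auto dest: sym\<close>)
    then have card: "card ?A = nat c"
      by (simp add: card_image)
    have "independent_set G ?A"
      unfolding independent_set_def
    proof (intro conjI ballI impI)
      show "?A \<subseteq> verts G"
        using \<psi> by auto
      fix u v assume "u \<in> ?A" "v \<in> ?A" "u \<noteq> v"
      moreover from this obtain s t where
        "s \<in> {0..<c}" "t \<in> {0..<c}" "u = \<psi> (s * l)" "v = \<psi> (t * l)"
        by (elim imageE) auto
      ultimately have "s \<noteq> t"
        by auto
      with \<open>s \<in> {0..<c}\<close> \<open>t \<in> {0..<c}\<close> \<open>u = _\<close> \<open>v = _\<close> show "{u, v} \<notin> edges G"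
        using nonadj[of s t] nonadj[of t s] by (cases "s < t") (auto simp: insert_commute)
    qed
    then obtain B where "independent_set H B" "card ?A \<le> card B"
      by (rule dominated_independent_set[OF fin le])
    moreover have "a div l < c" if "a \<in> {0..<N}" for a
      using that mult by (intro div_less) simp
    ultimately show thesis
      using cover[of c B] card c by simp
  next
    case zero
    have "independent_set G {\<psi> 0}"
      using \<psi> by (auto simp: independent_set_def)
    then obtain B where "independent_set H B" "card {\<psi> 0} \<le> card B"
      by (rule dominated_independent_set[OF fin le])
    moreover have "a div l < 1" if "a \<in> {0..<N}" for a
      using that zero l by (intro div_less) simp
    ultimately show thesis
      using cover[of 1 B] by simp
  next
    case succ
    have "verts G \<noteq> {}"
      using \<psi>(1) by auto
    then obtain S where S: "\<And>v. v \<in> verts G \<Longrightarrow> independent_set H (S v)"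
      "\<And>u v x y. \<lbrakk>u \<in> verts G; v \<in> verts G; u \<noteq> v; {u, v} \<notin> edges G; x \<in> S u; y \<in> S v\<rbrakk>
         \<Longrightarrow> x \<noteq> y \<and> {x, y} \<notin> edges H"
      "card (verts G) \<le> (\<Sum>v\<in>verts G. card (S v))"
      using dominated_independent_family[OF G H le] by blast
    define s where "s i = card (S (\<psi> i))" for i
    define d where "d = nat c"
    have d: "int d = c"
      using succ by (simp add: d_def)
    have s_mod: "s (i mod N) = s i" for i
      by (simp add: s_def \<psi>_def)
    have sum_s: "(\<Sum>v\<in>verts G. card (S v)) = (\<Sum>i\<in>{0..<N}. s i)"
    proof -
      have "(\<Sum>v\<in>verts G. card (S v)) = (\<Sum>v\<in>verts G. s (\<phi> v))"
      proof (rule sum.cong)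
        fix v assume "v \<in> verts G"
        then have "\<psi> (\<phi> v) = v"
          using \<phi>N[of v] \<phi>(1) by (simp add: \<psi>_def bij_betw_def inv_into_f_f)
        then show "card (S v) = s (\<phi> v)"
          by (simp add: s_def)
      qed simp
      also have "\<dots> = (\<Sum>i\<in>{0..<N}. s i)"
        by (rule sum.reindex_bij_betw[OF \<phi>(1)])
      finally show ?thesis .
    qed
    have total: "n \<le> (\<Sum>i\<in>{0..<N}. s i)"
      using S(3) bij_betw_same_card[OF \<phi>(1)] by (simp add: sum_s N_def)
    define w where "w i = (\<Sum>t<d. s (i + int t * l))" for i
    \<comment> \<open>The largest gap in the progression is \<open>(c - 1) * l = N - 1 - l\<close>,
      so its positions are pairwise nonadjacent, and the sets there are disjoint and without edges
      between them.\<close>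
    have union: "\<exists>B. independent_set H B \<and> card B = w i" for i
    proof -
      let ?T = "\<lambda>t. S (\<psi> (i + int t * l))"
      have nonadj: "\<psi> (i + int t * l) \<noteq> \<psi> (i + int t' * l) \<and>
          {\<psi> (i + int t * l), \<psi> (i + int t' * l)} \<notin> edges G"
        if "t' < t" "t < d" for t t'
      proof -
        have "1 * l \<le> (int t - int t') * l" "(int t - int t') * l \<le> (c - 1) * l"
          using that l d by (auto intro!: mult_right_mono)
        then show ?thesis
          using succ by (intro \<psi>_nonadj) (auto simp: algebra_simps)
      qed
      have sep: "x \<noteq> y \<and> {x, y} \<notin> edges H" if "t < d" "t' < d" "t \<noteq> t'" "x \<in> ?T t" "y \<in> ?T t'"
        for t t' x y
      proof (cases "t' < t")
        case True
        then show ?thesis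
          using nonadj[of t' t] S(2) \<psi>(1) that by blast
      next
        case False
        then have "y \<noteq> x \<and> {y, x} \<notin> edges H"
          using nonadj[of t t'] S(2)[of _ _ y x] \<psi>(1) that by (metis nat_neq_iff)
        then show ?thesis
          by (auto simp: insert_commute)
      qed
      have "independent_set H (\<Union>t<d. ?T t)"
        unfolding independent_set_def
      proof (intro conjI ballI impI)
        show "(\<Union>t<d. ?T t) \<subseteq> verts H"
          using S(1) \<psi>(1) by (auto simp: independent_set_def)
        fix x y assume "x \<in> (\<Union>t<d. ?T t)" "y \<in> (\<Union>t<d. ?T t)" "x \<noteq> y"
        then obtain t t' where "t < d" "t' < d" "x \<in> ?T t" "y \<in> ?T t'"
          by auto
        then show "{x, y} \<notin> edges H"
          using sep[of t t' x y] S(1)[OF \<psi>(1)] \<open>x \<noteq> y\<close>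
          by (cases "t = t'") (auto simp: independent_set_def)
      qed
      moreover have "card (\<Union>t<d. ?T t) = w i"
      proof -
        have "finite (?T t)" for t
          using S(1)[OF \<psi>(1), of "i + int t * l"] finite_subset[OF _ fin(2)]
          unfolding independent_set_def by blast
        moreover have "?T t \<inter> ?T t' = {}" if "t < d" "t' < d" "t \<noteq> t'" for t t'
          using sep[OF that] by blast
        ultimately show ?thesis
          unfolding w_def s_def by (intro card_UN_disjoint) auto
      qed
      ultimately show ?thesis
        by blast
    qed
    show thesis
    proof (cases "\<exists>i. d < w i")
      case True
      then obtain i B where "independent_set H B" "card B = w i" "d < w i"
        using union by blast
      \<comment> \<open>The last of the \<open>c + 1\<close> blocks consists of the single residue
        \<open>c * l\<close>.\<close>
      moreover have "a div l < c + 1" if "a \<in> {0..<N}" for a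
        using that succ l by (intro div_less) (simp add: algebra_simps)
      ultimately show thesis
        using cover[of "c + 1" B] d by simp
    next
      case False
      \<comment> \<open>Here no progression sum exceeds \<open>d\<close>, so the averaging argument
        makes every \<open>S v\<close> nonempty.\<close>
      have s_pos: "0 < s i" for i
        using progression_sums_le_imp_pos[of N d l s i] N s_mod total succ d False
        by (simp add: w_def N_def not_less)
      have "S v \<noteq> {}" if "v \<in> verts G" for v
      proof -
        have "\<psi> (\<phi> v) = v"
          using \<phi>N[OF that] \<phi>(1) that by (simp add: \<psi>_def bij_betw_def inv_into_f_f)
        then show ?thesis
          using s_pos[of "\<phi> v"] by (auto simp: s_def)
      qed
      then have f: "(SOME x. x \<in> S v) \<in> S v" if "v \<in> verts G" for v
        using that by (simp add: some_in_eq)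
      have "co_hom G H (\<lambda>v. SOME x. x \<in> S v)"
        unfolding co_hom_def
      proof (intro conjI ballI impI)
        show "(\<lambda>v. SOME x. x \<in> S v) ` verts G \<subseteq> verts H"
          using f S(1) unfolding independent_set_def by blast
      qed (use S(2) f in blast)+
      then show thesis
        by (rule found)
    qed
  qed
qed

theorem theorem9:
  fixes G :: "'a ugraph" and H :: "'b ugraph"
  assumes "simple_graph G" and "simple_graph H"
    and "alpha_star G H \<le> 1"
  shows "(\<forall>(n::nat) (k::nat) (c::int).
            n \<ge> 1 \<and>
            (int n = c * (int k + 1) + 1 \<or> int n = c * (int k + 1)) \<and>
            graph_iso G (cayley_cyclic n k) \<longrightarrow> G \<in> Expand H) \<and>
         (perfect G \<longrightarrow> G \<in> Expand H)"
proof (intro conjI allI impI)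
  fix n k :: nat and c :: int
  assume "n \<ge> 1 \<and> (int n = c * (int k + 1) + 1 \<or> int n = c * (int k + 1)) \<and>
    graph_iso G (cayley_cyclic n k)"
  then obtain f where "co_hom G H f"
    using cayley_cyclic_co_hom[OF assms] by blast
  then show "G \<in> Expand H"
    by (rule co_hom_imp_Expand[OF assms(1,2)])
next
  assume "perfect G"
  then obtain f where "co_hom G H f"
    using perfect_co_hom[OF assms] by blast
  then show "G \<in> Expand H"
    by (rule co_hom_imp_Expand[OF assms(1,2)])
qed

end
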